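(* Let $K$ be a compact Hausdorff space. The following are equivalent: (i) $K$ has finitely many non-isolated points; (ii) $\mathcal{C}(K)_a$ has finite codimension in $\mathcal{C}(K)$; (iii) the pointwise topology on $\mathcal{C}(K)$ has the Kadec-Pelczynski property; (iii$'$) the pointwise topology on $\mathcal{C}(K)$ has the sequential Kadec-Pelczynski property; (iv) the weak topology on $\mathcal{C}(K)$ has the sequential Kadec-Pelczynski property; (iv$'$) the absolute weak topology on $\mathcal{C}(K)$ has the sequential Kadec-Pelczynski property; (v) $\mathcal{C}(K)$ contains no infinite-dimensional dispersed closed subspace; (v$'$) $\mathcal{C}(K)$ contains no infinite-dimensional $2$-dispersed closed subspace.
   Context: $\mathcal{C}(K)$ is the Banach lattice of real continuous functions with sup-norm and pointwise order. For a Banach lattice $F$, $F_a$ is its order continuous part: the largest ideal of $F$ on which the norm is order continuous. $\mathrm{S}_F$ is the unit sphere. A sequence $(e_n)\subset\mathrm{S}_F$ is almost disjoint if there is a disjoint sequence $(f_n)\subset F$ ($|f_n|\wedge|f_m|=0$, $n\neq m$) with $\|e_n-f_n\|\to0$. A closed subspace $E$ is dispersed if it contains no almost disjoint sequence; it is $2$-dispersed if there is $r>0$ such that there are no disjoint $f_1,f_2\in\mathrm{S}_F$ with $d(f_1,E)<r$ and $d(f_2,E)<r$. A linear topology $\tau$ on $F$ has the Kadec-Pelczynski property if whenever $(f_p)_{p\in P}\subset\mathrm{S}_F$ is a $\tau$-null net and $(q_n)_{n\in\mathbb{N}}\subset P$, there are $p_n\in P$ with $p_n\ge q_n$ for all $n$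 such that $(f_{p_n})_n$ is almost disjoint; it has the sequential Kadec-Pelczynski property if every $\tau$-null sequence in $\mathrm{S}_F$ has an almost disjoint subsequence. The absolute weak topology is the linear topology with zero neighborhood base $\{f:\nu(|f|)<\varepsilon\}$, $\nu\in F^*_+$, $\varepsilon>0$. *)

theory Defs
  imports "HOL-Analysis.Analysis"
begin

text \<open>The Banach lattice C(K) is modelled by the type of bounded continuous real
functions on K (for compact K these are all continuous functions), with its
library sup-norm; the order and lattice operations are pointwise.\<close>

type_synonym 'a CK = "'a \<Rightarrow>\<^sub>C real"

definition cle :: "'a::topological_space CK \<Rightarrow> 'a CK \<Rightarrow> bool" where
  "cle f g \<longleftrightarrow> (\<forall>x. apply_bcontfun f x \<le> apply_bcontfun g x)"

definition cabs :: "'a::topological_space CK \<Rightarrow> 'a CK" where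
  "cabs f = Bcontfun (\<lambda>x. \<bar>apply_bcontfun f x\<bar>)"

definition cdisj :: "'a::topological_space CK \<Rightarrow> 'a CK \<Rightarrow> bool" where
  "cdisj f g \<longleftrightarrow> (\<forall>x. min \<bar>apply_bcontfun f x\<bar> \<bar>apply_bcontfun g x\<bar> = 0)"

definition unit_sphere :: "'a::topological_space CK set" where
  "unit_sphere = {f. norm f = 1}"

definition is_ideal :: "'a::topological_space CK set \<Rightarrow> bool" where
  "is_ideal I \<longleftrightarrow> subspace I \<and>
     (\<forall>f g. f \<in> I \<and> cle (cabs g) (cabs f) \<longrightarrow> g \<in> I)"

text \<open>The norm is order continuous on I: whenever a downward directed set D of
elements of I decreases to 0 (i.e. D is bounded below by 0 and 0 is its infimum
in C(K)), the norms tend to 0 along D, i.e. their infimum is 0.\<close>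
definition order_cont_on :: "'a::topological_space CK set \<Rightarrow> bool" where
  "order_cont_on I \<longleftrightarrow>
     (\<forall>D. D \<subseteq> I \<and> D \<noteq> {} \<and>
          (\<forall>d1\<in>D. \<forall>d2\<in>D. \<exists>d\<in>D. cle d d1 \<and> cle d d2) \<and>
          (\<forall>d\<in>D. cle 0 d) \<and>
          (\<forall>h. (\<forall>d\<in>D. cle h d) \<longrightarrow> cle h 0)
        \<longrightarrow> (INF d\<in>D. norm d) = 0)"

definition oc_part :: "'a::topological_space CK set" where
  "oc_part = (THE I. is_ideal I \<and> order_cont_on I \<and>
                (\<forall>J. is_ideal J \<and> order_cont_on J \<longrightarrow> J \<subseteq> I))"

definition finite_codim :: "'a::topological_space CK set \<Rightarrow> bool" where
  "finite_codim E \<longleftrightarrow> (\<exists>S. finite S \<and> span (E \<union> S) = UNIV)"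

definition almost_disjoint :: "(nat \<Rightarrow> 'a::topological_space CK) \<Rightarrow> bool" where
  "almost_disjoint e \<longleftrightarrow> (\<forall>n. e n \<in> unit_sphere) \<and>
     (\<exists>f. (\<forall>n m. n \<noteq> m \<longrightarrow> cdisj (f n) (f m)) \<and>
          (\<lambda>n. norm (e n - f n)) \<longlonglongrightarrow> 0)"

text \<open>Linear topologies are given by a family Ns of seminorms generating them
(zero neighbourhoods: finite intersections of sets N f < eps).
A net is a map from a set P with a directed preorder le.\<close>
definition directed_set :: "'p set \<Rightarrow> ('p \<Rightarrow> 'p \<Rightarrow> bool) \<Rightarrow> bool" where
  "directed_set P le \<longleftrightarrow> (\<forall>p\<in>P. le p p) \<and>
     (\<forall>p\<in>P. \<forall>q\<in>P. \<forall>r\<in>P. le p q \<and> le q r \<longrightarrow> le p r) \<and>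
     (\<forall>p\<in>P. \<forall>q\<in>P. \<exists>r\<in>P. le p r \<and> le q r)"

definition net_null :: "'p set \<Rightarrow> ('p \<Rightarrow> 'p \<Rightarrow> bool) \<Rightarrow> ('p \<Rightarrow> real) \<Rightarrow> bool" where
  "net_null P le g \<longleftrightarrow>
     (\<forall>\<epsilon>>0. \<exists>p0\<in>P. \<forall>p\<in>P. le p0 p \<longrightarrow> \<bar>g p\<bar> < \<epsilon>)"

definition tau_null_net ::
  "('a::topological_space CK \<Rightarrow> real) set \<Rightarrow> 'p set \<Rightarrow> ('p \<Rightarrow> 'p \<Rightarrow> bool) \<Rightarrow> ('p \<Rightarrow> 'a CK) \<Rightarrow> bool" where
  "tau_null_net Ns P le f \<longleftrightarrow> (\<forall>N\<in>Ns. net_null P le (\<lambda>p. N (f p)))"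

definition tau_null_seq ::
  "('a::topological_space CK \<Rightarrow> real) set \<Rightarrow> (nat \<Rightarrow> 'a CK) \<Rightarrow> bool" where
  "tau_null_seq Ns f \<longleftrightarrow> (\<forall>N\<in>Ns. (\<lambda>n. N (f n)) \<longlonglongrightarrow> 0)"

definition KP_property ::
  "('a::topological_space CK \<Rightarrow> real) set \<Rightarrow> 'p itself \<Rightarrow> bool" where
  "KP_property Ns (_ :: 'p itself) \<longleftrightarrow>
     (\<forall>(P :: 'p set) le f. directed_set P le \<and> (\<forall>p\<in>P. f p \<in> unit_sphere) \<and>
        tau_null_net Ns P le f \<longrightarrow>
        (\<forall>q. (\<forall>n. q n \<in> P) \<longrightarrow>
           (\<exists>pn. (\<forall>n. pn n \<in> P \<and> le (q n) (pn n)) \<and> almost_disjoint (f \<circ> pn))))"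

definition seq_KP_property :: "('a::topological_space CK \<Rightarrow> real) set \<Rightarrow> bool" where
  "seq_KP_property Ns \<longleftrightarrow>
     (\<forall>f. (\<forall>n. f n \<in> unit_sphere) \<and> tau_null_seq Ns f \<longrightarrow>
        (\<exists>r. strict_mono r \<and> almost_disjoint (f \<circ> r)))"

definition pointwise_sn :: "('a::topological_space CK \<Rightarrow> real) set" where
  "pointwise_sn = {(\<lambda>f. \<bar>apply_bcontfun f x\<bar>) | x. True}"

definition weak_sn :: "('a::topological_space CK \<Rightarrow> real) set" where
  "weak_sn = {(\<lambda>f. \<bar>\<phi> f\<bar>) | \<phi>. bounded_linear \<phi>}"

definition positive_functional :: "('a::topological_space CK \<Rightarrow> real) \<Rightarrow> bool" where
  "positive_functional \<nu> \<longleftrightarrow> bounded_linear \<nu> \<and> (\<forall>f. cle 0 f \<longrightarrow> \<nu> f \<ge> 0)"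

definition abs_weak_sn :: "('a::topological_space CK \<Rightarrow> real) set" where
  "abs_weak_sn = {(\<lambda>f. \<nu> (cabs f)) | \<nu>. positive_functional \<nu>}"

definition closed_subspace :: "'a::topological_space CK set \<Rightarrow> bool" where
  "closed_subspace E \<longleftrightarrow> subspace E \<and> closed E"

definition infinite_dim :: "'a::topological_space CK set \<Rightarrow> bool" where
  "infinite_dim E \<longleftrightarrow> \<not> (\<exists>B. finite B \<and> E \<subseteq> span B)"

definition dispersed :: "'a::topological_space CK set \<Rightarrow> bool" where
  "dispersed E \<longleftrightarrow> closed_subspace E \<and>
     \<not> (\<exists>e. (\<forall>n. e n \<in> E) \<and> almost_disjoint e)"

definition two_dispersed :: "'a::topological_space CK set \<Rightarrow> bool" where
  "two_dispersed E \<longleftrightarrow> closed_subspace E \<and>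
     (\<exists>r>0. \<not> (\<exists>f1 f2. cdisj f1 f2 \<and> f1 \<in> unit_sphere \<and> f2 \<in> unit_sphere \<and>
                     infdist f1 E < r \<and> infdist f2 E < r))"

end

theory Submission
  imports Defs
begin

text \<open>If the set \<open>K'\<close> of non-isolated points is finite, then a closed set missing \<open>K'\<close> is finite, so every
function which is small on \<open>K'\<close> is, up to a small error, finitely supported on isolated points. In a pointwise
null net, as in an infinite-dimensional subspace, one can find unit functions that are small on any given
finite set; choosing each one small on \<open>K'\<close> and on the supports of its predecessors gives an almost disjoint
sequence.

If \<open>K'\<close> is infinite, choose \<open>x n\<close> in \<open>K'\<close> with disjoint neighbourhoods \<open>U n\<close>, a bump \<open>g n\<close> supported in
\<open>U n\<close> with \<open>g n = 1\<close> near \<open>x n\<close>, and disjoint bumps \<open>h n m\<close> for all \<open>m\<close>, supported where \<open>g n = 1\<close>. The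
functions \<open>f m = g m + (h 0 m + ... + h (m-1) m) / 2\<close> have uniformly bounded partial sums, hence are weakly
null, but any two of them overlap. Their closed span is 2-dispersed, because the largest coefficients of two
elements can be seen at a common point.

The order continuous part of \<open>C(K)\<close> is the ideal of functions vanishing on \<open>K'\<close>.\<close>

section \<open>Evaluation at points, bump functions and isolated points\<close>

lemma apply_bcontfun_sum:
  "apply_bcontfun (sum f A) x = (\<Sum>i\<in>A. apply_bcontfun (f i :: 'a::topological_space CK) x)"
  by (induction A rule: infinite_finite_induct) auto

lemma bcontfun_of_continuous:
  fixes f :: "'a::topological_space \<Rightarrow> real"
  assumes "compact (UNIV :: 'a set)" "continuous_on UNIV f"
  obtains g :: "'a CK" where "\<And>x. apply_bcontfun g x = f x"
proof -
  have "f \<in> bcontfun"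
    using assms by (auto simp: bcontfun_def intro: compact_imp_bounded compact_continuous_image)
  then show ?thesis using that by (metis bcontfunE)
qed

lemma apply_cabs [simp]: "apply_bcontfun (cabs f) x = \<bar>apply_bcontfun f x\<bar>"
proof -
  have "(\<lambda>x. \<bar>apply_bcontfun f x\<bar>) \<in> bcontfun"
    by (rule bcontfun_normI[where b = "norm f"])
       (use norm_bounded[of f] in \<open>auto intro!: continuous_intros\<close>)
  then show ?thesis by (simp add: cabs_def Bcontfun_inverse)
qed

lemma abs_apply_le_norm: "\<bar>apply_bcontfun f x\<bar> \<le> norm (f :: 'a::topological_space CK)"
  using norm_bounded[of f x] by simp

lemma cdisj_iff: "cdisj f g \<longleftrightarrow> (\<forall>x. apply_bcontfun f x = 0 \<or> apply_bcontfun g x = 0)"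
proof -
  have "min \<bar>a\<bar> \<bar>b\<bar> = 0 \<longleftrightarrow> a = 0 \<or> b = 0" for a b :: real by (auto simp: min_def)
  then show ?thesis by (simp add: cdisj_def)
qed

lemma bounded_linear_apply: "bounded_linear (\<lambda>f :: 'a::topological_space CK. apply_bcontfun f x)"
  by (rule bounded_linear_intro[where K = 1]) (use abs_apply_le_norm in auto)

lemma closed_level_set: "closed {x. c \<le> \<bar>apply_bcontfun (f :: 'a::topological_space CK) x\<bar>}"
  by (rule closed_Collect_le) (auto intro: continuous_on_rabs)

text \<open>Urysohn's lemma separates \<open>x\<close> from the complement of \<open>U\<close>.
  Doubling that function and truncating it at 1 makes it constant 1 on the open set where it exceeds
  1/2, which serves as \<open>W\<close>.\<close>

lemma exists_bump:
  fixes x :: "'a::t2_space"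
  assumes "compact (UNIV :: 'a set)" "open U" "x \<in> U"
  obtains \<phi> :: "'a CK" and W where "open W" "x \<in> W" "W \<subseteq> U"
    "\<And>y. 0 \<le> apply_bcontfun \<phi> y" "\<And>y. apply_bcontfun \<phi> y \<le> 1"
    "\<And>y. y \<in> W \<Longrightarrow> apply_bcontfun \<phi> y = 1" "\<And>y. y \<notin> U \<Longrightarrow> apply_bcontfun \<phi> y = 0"
proof -
  have "compact_space (euclidean :: 'a topology)"
    using assms(1) by (simp add: compact_space_def)
  moreover have "Hausdorff_space (euclidean :: 'a topology)"
    by (simp add: Hausdorff_space_def disjnt_def) (metis hausdorff)
  ultimately have "normal_space (euclidean :: 'a topology)"
    using compact_Hausdorff_or_regular_imp_normal_space by blast
  moreover have "closedin euclidean {x}" "closedin euclidean (-U)" "disjnt (-U) {x}"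
    using assms by (auto simp: closed_Compl)
  ultimately obtain f where f: "continuous_map (euclidean :: 'a topology) (top_of_set {0..1::real}) f"
    "f ` (-U) \<subseteq> {0}" "f ` {x} \<subseteq> {1}"
    using Urysohn_lemma[of euclidean "-U" "{x}" 0 1] by (metis zero_le_one)
  have cont: "continuous_on UNIV f"
    using f(1) continuous_map_into_fulltopology by fastforce
  have range: "0 \<le> f y" for y
    using f(1) by (auto simp: continuous_map_in_subtopology)
  have "continuous_on UNIV (\<lambda>y. min 1 (2 * f y))"
    by (intro continuous_intros cont)
  from bcontfun_of_continuous[OF assms(1) this] obtain \<phi> :: "'a CK"
    where \<phi>: "\<And>y. apply_bcontfun \<phi> y = min 1 (2 * f y)" by blast
  show ?thesis
  proof (rule that[of _ \<phi>])
    show "open {y. 1/2 < f y}" by (intro open_Collect_less cont continuous_intros)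
    show "{y. 1/2 < f y} \<subseteq> U" using f(2) by force
    show "x \<in> {y. 1/2 < f y}" using f(3) by simp
    show "0 \<le> apply_bcontfun \<phi> y" for y using range[of y] by (simp add: \<phi>)
    show "apply_bcontfun \<phi> y = 0" if "y \<notin> U" for y
    proof -
      have "f y = 0" using f(2) that by blast
      then show ?thesis by (simp add: \<phi>)
    qed
  qed (simp_all add: \<phi>)
qed

lemma infinite_nbhd_of_islimpt:
  fixes x :: "'a::t1_space"
  assumes "x islimpt UNIV" "open U" "x \<in> U"
  shows "infinite U"
proof
  assume "finite U"
  then have "open (U \<inter> - (U - {x}))"
    using assms(2) by (intro open_Int open_Compl finite_imp_closed) auto
  moreover have "U \<inter> - (U - {x}) = {x}" using assms(3) by auto
  ultimately show False using assms(1) by (simp add: islimpt_UNIV_iff)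
qed

text \<open>By compactness an infinite closed set contains one of its accumulation points, and such
  a point is not isolated.\<close>

lemma finite_closed_isolated:
  assumes "compact (UNIV :: 'a::topological_space set)" "closed F" "\<And>x. x \<in> F \<Longrightarrow> \<not> (x::'a) islimpt UNIV"
  shows "finite F"
proof (rule ccontr)
  assume "infinite F"
  moreover have "compact F" using assms(1,2) compact_Int_closed[of UNIV F] by simp
  ultimately obtain x where "x \<in> F" "x islimpt F"
    using Heine_Borel_imp_Bolzano_Weierstrass by blast
  then show False using assms(3) islimpt_subset by blast
qed

text \<open>A finite set of isolated points is clopen, so cutting off outside it preserves
  continuity.\<close>

lemma restrict_to_isolated:
  fixes f :: "'a::t1_space CK"
  assumes "finite F" "\<And>x. x \<in> F \<Longrightarrow> \<not> x islimpt UNIV"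
  obtains g :: "'a CK" where "\<And>x. apply_bcontfun g x = (if x \<in> F then apply_bcontfun f x else 0)"
proof -
  have "open (\<Union>x\<in>F. {x})" using assms(2) by (intro open_UN) (auto simp: islimpt_UNIV_iff)
  then have "closed (-F)" by (simp add: closed_Compl)
  then have "continuous_on (F \<union> -F) (\<lambda>x. if x \<in> F then apply_bcontfun f x else 0)"
    by (intro continuous_on_If) (auto simp: assms finite_imp_closed)
  then have "(\<lambda>x. if x \<in> F then apply_bcontfun f x else 0) \<in> bcontfun"
    by (intro bcontfun_normI[where b = "norm f"]) (use abs_apply_le_norm[of f] in \<open>auto simp: Un_commute\<close>)
  then obtain g :: "'a CK" where "(\<lambda>x. if x \<in> F then apply_bcontfun f x else 0) = apply_bcontfun g"
    by (rule bcontfunE)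
  then show ?thesis using that[of g] by (simp add: fun_eq_iff)
qed

text \<open>Dependent choice yields decreasing open sets \<open>V n\<close>, each containing
  infinitely many points of \<open>S\<close>; at every step a neighbourhood of one point of
  \<open>S\<close> is split off, disjoint from what remains.\<close>

lemma disjoint_neighbourhoods:
  fixes S :: "'a::t2_space set"
  assumes K: "compact (UNIV :: 'a set)" and "infinite S"
  obtains x :: "nat \<Rightarrow> 'a" and U where "\<And>n. x n \<in> S" "\<And>n. open (U n)" "\<And>n. x n \<in> U n"
    "\<And>n m. n \<noteq> m \<Longrightarrow> U n \<inter> U m = {}"
proof -
  define P where "P = (\<lambda>O'. open O' \<and> infinite (S \<inter> O'))"
  define Q where "Q = (\<lambda>O1 O2. O2 \<subseteq> O1 \<and> (\<exists>x U. x \<in> S \<and> x \<in> U \<and> open U \<and> U \<subseteq> O1 \<and> U \<inter> O2 = {}))"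
  have step: "\<exists>O2. P O2 \<and> Q O1 O2" if "P O1" for O1
  proof -
    have inf: "infinite (S \<inter> O1)" and op: "open O1" using that by (auto simp: P_def)
    obtain a where a: "a \<in> S \<inter> O1" using inf by (metis all_not_in_conv finite.emptyI)
    obtain b where b: "b \<in> S \<inter> O1" "b \<noteq> a"
      using inf by (metis finite.simps insertI1 subsetI finite_subset singletonI insert_iff)
    obtain \<phi> :: "'a CK" and W where \<phi>: "a \<in> W"
      "\<And>y. y \<in> W \<Longrightarrow> apply_bcontfun \<phi> y = 1" "\<And>y. y \<notin> -{b} \<Longrightarrow> apply_bcontfun \<phi> y = 0"
      by (rule exists_bump[OF K, of "-{b}" a]) (use b(2) in \<open>auto simp: open_Compl\<close>)
    have *: "open {y. c < apply_bcontfun \<phi> y}" "open {y. apply_bcontfun \<phi> y < c}" for c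
      by (intro open_Collect_less continuous_intros; simp)+
    \<comment> \<open>The two open pieces overlap and cover \<open>O1\<close>, so one of them keeps
      infinitely many points of \<open>S\<close>. If it is the piece where \<phi> is large, the
      neighbourhood split off surrounds \<open>b\<close>, where \<phi> vanishes; otherwise it
      surrounds \<open>a\<close>, where \<phi> is 1.\<close>
    have "S \<inter> O1 = (S \<inter> (O1 \<inter> {y. 1/3 < apply_bcontfun \<phi> y})) \<union> (S \<inter> (O1 \<inter> {y. apply_bcontfun \<phi> y < 2/3}))"
      by auto
    then consider "infinite (S \<inter> (O1 \<inter> {y. 1/3 < apply_bcontfun \<phi> y}))"
      | "infinite (S \<inter> (O1 \<inter> {y. apply_bcontfun \<phi> y < 2/3}))"
      using inf by (metis finite_Un)
    then show ?thesis
    proof cases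
      case 1
      have "Q O1 (O1 \<inter> {y. 1/3 < apply_bcontfun \<phi> y})"
        unfolding Q_def
        by (intro conjI exI[of _ b] exI[of _ "O1 \<inter> {y. apply_bcontfun \<phi> y < 1/3}"] open_Int op *)
           (use b \<phi>(3)[of b] in auto)
      moreover have "P (O1 \<inter> {y. 1/3 < apply_bcontfun \<phi> y})"
        unfolding P_def using 1 open_Int[OF op *(1)] by blast
      ultimately show ?thesis by blast
    next
      case 2
      have "Q O1 (O1 \<inter> {y. apply_bcontfun \<phi> y < 2/3})"
        unfolding Q_def
        by (intro conjI exI[of _ a] exI[of _ "O1 \<inter> {y. 2/3 < apply_bcontfun \<phi> y}"] open_Int op *)
           (use a \<phi>(1) \<phi>(2)[of a] in auto)
      moreover have "P (O1 \<inter> {y. apply_bcontfun \<phi> y < 2/3})"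
        unfolding P_def using 2 open_Int[OF op *(2)] by blast
      ultimately show ?thesis by blast
    qed
  qed
  have "P UNIV" using assms(2) by (simp add: P_def)
  then obtain V where V: "\<And>n. P (V n)" "\<And>n. Q (V n) (V (Suc n))"
    using dependent_nat_choice[of "\<lambda>_. P" "\<lambda>_. Q"] step by metis
  then obtain x U where xU: "\<And>n. x n \<in> S" "\<And>n. x n \<in> U n" "\<And>n. open (U n)" "\<And>n. U n \<subseteq> V n"
    "\<And>n. U n \<inter> V (Suc n) = {}"
    unfolding Q_def by metis
  \<comment> \<open>\<open>U n\<close> misses \<open>V (Suc n)\<close>, which contains every later
    \<open>U m\<close>.\<close>
  have "decseq V" using V(2) by (auto simp: Q_def decseq_Suc_iff)
  then have dis: "U n \<inter> U m = {}" if "n < m" for n m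
    using xU(4)[of m] xU(5)[of n] decseqD[of V "Suc n" m] that by fastforce
  have "U n \<inter> U m = {}" if "n \<noteq> m" for n m
    using that dis[of n m] dis[of m n] by (metis Int_commute nat_neq_iff)
  with xU that show thesis by blast
qed

section \<open>Almost disjoint selections and the Kadec-Pelczynski property\<close>

lemma almost_disjoint_selection:
  fixes f :: "'p \<Rightarrow> 'a::t2_space CK"
  assumes K: "compact (UNIV :: 'a set)" and fin: "finite {x :: 'a. x islimpt UNIV}"
    and sel: "\<And>n A \<epsilon>. finite A \<Longrightarrow> \<epsilon> > 0 \<Longrightarrow>
      \<exists>p. Q n p \<and> f p \<in> unit_sphere \<and> (\<forall>x\<in>A. \<bar>apply_bcontfun (f p) x\<bar> < \<epsilon>)"
  shows "\<exists>p. (\<forall>n::nat. Q n (p n)) \<and> almost_disjoint (\<lambda>n. f (p n))"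
proof -
  \<comment> \<open>Once small on the non-isolated points, a function is only large on a finite set F n p of isolated
    points, so it is close to its restriction to that clopen set; the next function is chosen small there.\<close>
  define F where "F = (\<lambda>n p. {x. (1/2::real)^n \<le> \<bar>apply_bcontfun (f p) x\<bar>})"
  define L where "L = {x :: 'a. x islimpt UNIV}"
  \<comment> \<open>A state carries the chosen index and a finite set \<open>A\<close> containing
    \<open>L\<close> and the set where the chosen function is large. As \<open>R\<close> only lets
    \<open>A\<close> grow, these sets accumulate, and the next one has to avoid them all.\<close>
  define P where "P = (\<lambda>n (p, A). Q n p \<and> f p \<in> unit_sphere \<and> finite A \<and> L \<subseteq> A \<and>
    F n p \<subseteq> A \<and> F n p \<inter> L = {})"
  define R where "R = (\<lambda>n (p :: 'p, A) (p', A' :: 'a set). A \<subseteq> A' \<and> F (Suc n) p' \<inter> A = {})"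
  have finF: "finite (F n p)" if "F n p \<inter> L = {}" for n p
    using that unfolding F_def L_def
    by (intro finite_closed_isolated[OF K]) (auto intro: closed_level_set)
  have ex: "\<exists>p. Q n p \<and> f p \<in> unit_sphere \<and> F n p \<inter> A = {}" if "finite A" for n A
    using sel[OF that, of "(1/2)^n" n] by (force simp: F_def not_le)
  have init: "\<exists>s. P 0 s"
  proof -
    obtain p where "Q 0 p" "f p \<in> unit_sphere" "F 0 p \<inter> L = {}"
      using ex fin L_def by metis
    then have "P 0 (p, L \<union> F 0 p)" using finF fin by (auto simp: P_def L_def)
    then show ?thesis ..
  qed
  have step: "\<exists>s'. P (Suc n) s' \<and> R n s s'" if "P n s" for n s
  proof -
    obtain q A where s: "s = (q, A)" by fastforce
    have A: "finite A" "L \<subseteq> A" using that by (auto simp: s P_def)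
    obtain p where p: "Q (Suc n) p" "f p \<in> unit_sphere" "F (Suc n) p \<inter> A = {}"
      using ex[OF A(1)] by metis
    then have "F (Suc n) p \<inter> L = {}" using A by auto
    then have "P (Suc n) (p, A \<union> F (Suc n) p) \<and> R n s (p, A \<union> F (Suc n) p)"
      using p A finF by (auto simp: P_def R_def s)
    then show ?thesis ..
  qed
  obtain s where s: "\<And>n. P n (s n)" "\<And>n. R n (s n) (s (Suc n))"
    using dependent_nat_choice[of P R] init step by metis
  define p where "p = (\<lambda>n. fst (s n))"
  define A where "A = (\<lambda>n. snd (s n))"
  have P: "Q n (p n)" "f (p n) \<in> unit_sphere" "F n (p n) \<subseteq> A n" "F n (p n) \<inter> L = {}" for n
    using s(1)[of n] by (auto simp: P_def p_def A_def split: prod.splits)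
  have R: "A n \<subseteq> A (Suc n)" "F (Suc n) (p (Suc n)) \<inter> A n = {}" for n
    using s(2)[of n] by (auto simp: R_def p_def A_def split: prod.splits)
  have "incseq A" using R(1) by (simp add: incseq_Suc_iff)
  have disj: "F n (p n) \<inter> F m (p m) = {}" if "n < m" for n m
  proof -
    have "\<exists>k. m = Suc k \<and> n \<le> k" using less_imp_Suc_add[OF that] by auto
    then obtain k where k: "m = Suc k" "n \<le> k" by blast
    then show ?thesis using R(2)[of k] P(3)[of n] incseqD[OF \<open>incseq A\<close>, of n k] by auto
  qed
  have disj': "F n (p n) \<inter> F m (p m) = {}" if "n \<noteq> m" for n m
    using that disj[of n m] disj[of m n] by (metis Int_commute nat_neq_iff)
  have "\<exists>g :: 'a CK. \<forall>x. apply_bcontfun g x = (if x \<in> F n (p n) then apply_bcontfun (f (p n)) x else 0)" for n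
    using restrict_to_isolated[OF finF[OF P(4)[of n]], of "f (p n)"] P(4)[of n] unfolding L_def by blast
  then obtain g :: "nat \<Rightarrow> 'a CK" where
    g: "\<And>n x. apply_bcontfun (g n) x = (if x \<in> F n (p n) then apply_bcontfun (f (p n)) x else 0)"
    by metis
  have "cdisj (g n) (g m)" if "n \<noteq> m" for n m
    using disj'[OF that] by (auto simp: cdisj_iff g)
  \<comment> \<open>The two functions agree on \<open>F n (p n)\<close>; off it \<open>g n\<close>
    vanishes and \<open>f (p n)\<close> is below the threshold \<open>(1/2)^n\<close> in
    modulus.\<close>
  moreover have "norm (f (p n) - g n) \<le> (1/2)^n" for n
    by (rule norm_bound) (auto simp: g F_def)
  then have "(\<lambda>n. norm (f (p n) - g n)) \<longlonglongrightarrow> 0"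
    by (intro tendsto_sandwich[OF _ _ tendsto_const LIMSEQ_realpow_zero[of "1/2::real"]] always_eventually) auto
  ultimately have "almost_disjoint (\<lambda>n. f (p n))"
    unfolding almost_disjoint_def by (intro conjI exI[of _ g]) (simp_all add: P(2))
  then show ?thesis by (intro exI[of _ p] conjI allI P(1))
qed

text \<open>Directedness merges finitely many thresholds, and the index \<open>q\<close>, into one
  later index.\<close>

lemma net_null_finite:
  assumes dir: "directed_set P le" and "q \<in> P" "finite A"
    and null: "\<And>x. x \<in> A \<Longrightarrow> net_null P le (g x)" and "\<epsilon> > 0"
  shows "\<exists>p\<in>P. le q p \<and> (\<forall>x\<in>A. \<bar>g x p\<bar> < \<epsilon>)"
proof -
  have refl: "le p p" if "p \<in> P" for p
    using dir that by (simp add: directed_set_def)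
  have trans: "le a c" if "le a b" "le b c" "a \<in> P" "b \<in> P" "c \<in> P" for a b c
    using dir that unfolding directed_set_def by meson
  \<comment> \<open>Smallness is claimed on a whole tail, since the induction step moves on to a
    later index.\<close>
  have "\<exists>p\<in>P. le q p \<and> (\<forall>r\<in>P. le p r \<longrightarrow> (\<forall>x\<in>A. \<bar>g x r\<bar> < \<epsilon>))"
    using \<open>finite A\<close> null
  proof (induction A)
    case empty
    show ?case using \<open>q \<in> P\<close> refl[of q] by (intro bexI[of _ q]) simp_all
  next
    case (insert a A)
    then obtain p where p: "p \<in> P" "le q p" "\<forall>r\<in>P. le p r \<longrightarrow> (\<forall>x\<in>A. \<bar>g x r\<bar> < \<epsilon>)"
      by auto
    obtain p' where p': "p' \<in> P" "\<forall>r\<in>P. le p' r \<longrightarrow> \<bar>g a r\<bar> < \<epsilon>"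
      using insert.prems[of a] \<open>\<epsilon> > 0\<close> by (auto simp: net_null_def)
    obtain p'' where p'': "p'' \<in> P" "le p p''" "le p' p''"
      using dir p(1) p'(1) unfolding directed_set_def by meson
    have "\<bar>g x r\<bar> < \<epsilon>" if r: "r \<in> P" "le p'' r" "x \<in> insert a A" for r x
    proof -
      have "le p r" "le p' r"
        using trans[of p p'' r] trans[of p' p'' r] p(1) p'(1) p'' r(1,2) by simp_all
      then show ?thesis using p(3) p'(2) r(1,3) by auto
    qed
    then show ?case
      using p''(1) trans[OF p(2) p''(2) \<open>q \<in> P\<close> p(1) p''(1)] by (intro bexI[of _ p'']) simp_all
  qed
  then obtain p where "p \<in> P" "le q p" "\<forall>r\<in>P. le p r \<longrightarrow> (\<forall>x\<in>A. \<bar>g x r\<bar> < \<epsilon>)"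
    by auto
  then show ?thesis using refl[of p] by (intro bexI[of _ p]) simp_all
qed

text \<open>Beyond each \<open>q n\<close> a pointwise null net becomes small on any given finite
  set, which is what the selection lemma asks for; its predicate \<open>Q\<close> carries the
  cofinality condition on the chosen indices.\<close>

lemma KP_pointwise:
  assumes K: "compact (UNIV :: 'a::t2_space set)" and fin: "finite {x :: 'a. x islimpt UNIV}"
  shows "KP_property (pointwise_sn :: ('a CK \<Rightarrow> real) set) TYPE('p)"
  unfolding KP_property_def
proof (intro allI impI)
  fix P :: "'p set" and le and f :: "'p \<Rightarrow> 'a CK" and q :: "nat \<Rightarrow> 'p"
  assume H: "directed_set P le \<and> (\<forall>p\<in>P. f p \<in> unit_sphere) \<and> tau_null_net pointwise_sn P le f"
    and q: "\<forall>n. q n \<in> P"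
  have null: "net_null P le (\<lambda>p. \<bar>apply_bcontfun (f p) x\<bar>)" for x
    using H unfolding tau_null_net_def pointwise_sn_def by auto
  have sel: "\<exists>p. (p \<in> P \<and> le (q n) p) \<and> f p \<in> unit_sphere \<and> (\<forall>x\<in>A. \<bar>apply_bcontfun (f p) x\<bar> < \<epsilon>)"
    if "finite A" "\<epsilon> > 0" for n A \<epsilon>
    using net_null_finite[of P le "q n" A "\<lambda>x p. \<bar>apply_bcontfun (f p) x\<bar>" \<epsilon>] H q null that
    by auto
  show "\<exists>pn. (\<forall>n. pn n \<in> P \<and> le (q n) (pn n)) \<and> almost_disjoint (f \<circ> pn)"
    unfolding comp_def
    by (rule almost_disjoint_selection[OF K fin, where Q = "\<lambda>n p. p \<in> P \<and> le (q n) p"]) (rule sel)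
qed

lemma almost_disjoint_subseq:
  assumes "almost_disjoint e" "strict_mono r"
  shows "almost_disjoint (e \<circ> r)"
proof -
  obtain f where f: "\<And>n m. n \<noteq> m \<Longrightarrow> cdisj (f n) (f m)" "(\<lambda>n. norm (e n - f n)) \<longlonglongrightarrow> 0"
    "\<And>n. e n \<in> unit_sphere"
    using assms(1) unfolding almost_disjoint_def by blast
  have "(\<lambda>n. norm ((e \<circ> r) n - (f \<circ> r) n)) \<longlonglongrightarrow> 0"
    using LIMSEQ_subseq_LIMSEQ[OF f(2) assms(2)] by (simp add: comp_def)
  moreover have "cdisj ((f \<circ> r) n) ((f \<circ> r) m)" if "n \<noteq> m" for n m
    using f(1) strict_mono_eq[OF assms(2)] that by simp
  ultimately show ?thesis
    unfolding almost_disjoint_def by (intro conjI exI[of _ "f \<circ> r"]) (simp_all add: f(3))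
qed

text \<open>A sequence is a net over the natural numbers. Taking \<open>q\<close> to be the identity
  gives indices \<open>p n\<close> with \<open>n \<le> p n\<close>, which still have to be thinned
  out to an increasing sequence.\<close>

lemma seq_KP_of_KP:
  assumes KP: "KP_property Ns TYPE(nat)"
  shows "seq_KP_property Ns"
  unfolding seq_KP_property_def
proof (intro allI impI)
  fix f assume H: "(\<forall>n. f n \<in> unit_sphere) \<and> tau_null_seq Ns f"
  have "directed_set (UNIV :: nat set) (\<le>)"
    by (simp add: directed_set_def) (meson nat_le_linear order_refl order_trans)
  moreover have "tau_null_net Ns (UNIV :: nat set) (\<le>) f"
    using H unfolding tau_null_net_def tau_null_seq_def net_null_def LIMSEQ_iff by simp
  ultimately obtain p where p: "\<And>n. n \<le> p n" "almost_disjoint (f \<circ> p)"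
    using KP[unfolded KP_property_def, rule_format, of UNIV "(\<le>)" f id] H by auto
  \<comment> \<open>With \<open>r (n+1) = p (r n) + 1\<close>, the value of \<open>p\<close> at
    \<open>r (n+1)\<close> is at least \<open>r (n+1)\<close> and hence exceeds
    \<open>p (r n)\<close>.\<close>
  define r where "r = rec_nat 0 (\<lambda>_ k. Suc (p k))"
  have r: "r (Suc n) = Suc (p (r n))" for n by (simp add: r_def)
  have "strict_mono r" using p(1) by (auto simp: strict_mono_Suc_iff r less_Suc_eq_le)
  moreover have "p (r n) < p (r (Suc n))" for n using p(1)[of "r (Suc n)"] by (simp add: r)
  then have "strict_mono (p \<circ> r)" by (simp add: strict_mono_Suc_iff)
  ultimately show "\<exists>r. strict_mono r \<and> almost_disjoint (f \<circ> r)"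
    using almost_disjoint_subseq[OF p(2)] by (metis comp_assoc)
qed

text \<open>More seminorms leave fewer null sequences to be tested.\<close>

lemma seq_KP_antimono:
  assumes "seq_KP_property Ns" "Ns \<subseteq> Ms"
  shows "seq_KP_property Ms"
  using assms unfolding seq_KP_property_def tau_null_seq_def by blast

lemma pointwise_subset_weak: "pointwise_sn \<subseteq> weak_sn"
  unfolding pointwise_sn_def weak_sn_def using bounded_linear_apply by fast

lemma pointwise_subset_abs_weak: "pointwise_sn \<subseteq> (abs_weak_sn :: ('a::topological_space CK \<Rightarrow> real) set)"
proof
  fix N :: "'a CK \<Rightarrow> real" assume "N \<in> pointwise_sn"
  then obtain x where "N = (\<lambda>f. \<bar>apply_bcontfun f x\<bar>)" by (auto simp: pointwise_sn_def)
  moreover have "positive_functional (\<lambda>f :: 'a CK. apply_bcontfun f x)"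
    by (simp add: positive_functional_def bounded_linear_apply cle_def)
  ultimately show "N \<in> abs_weak_sn"
    unfolding abs_weak_sn_def by (intro CollectI exI[of _ "\<lambda>f. apply_bcontfun f x"]) simp
qed

section \<open>Infinite-dimensional and dispersed subspaces\<close>

text \<open>Each condition \<open>f a = 0\<close> lowers the dimension by at most one, so finitely
  many of them leave an infinite-dimensional subspace; any nonzero member of it is
  normalised.\<close>

lemma infinite_dim_kernel:
  assumes "subspace E" "infinite_dim E" "finite A"
  shows "\<exists>f\<in>E. f \<in> unit_sphere \<and> (\<forall>x\<in>A. apply_bcontfun f x = 0)"
proof -
  have "infinite_dim {f \<in> E. \<forall>x\<in>A. apply_bcontfun f x = 0}"
    using assms(3)
  proof induction
    case empty
    then show ?case using assms(2) by simp
  next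
    case (insert a A)
    let ?E = "{f \<in> E. \<forall>x\<in>A. apply_bcontfun f x = 0}"
    let ?E' = "{f \<in> E. \<forall>x\<in>insert a A. apply_bcontfun f x = 0}"
    show ?case
    proof (cases "\<exists>g\<in>?E. apply_bcontfun g a \<noteq> 0")
      case False
      then have "?E' = ?E" by auto
      then show ?thesis using insert by simp
    next
      case True
      then obtain g where g: "g \<in> ?E" "apply_bcontfun g a \<noteq> 0" by auto
      show ?thesis
        unfolding infinite_dim_def
      proof
        assume "\<exists>B. finite B \<and> ?E' \<subseteq> span B"
        then obtain B where B: "finite B" "?E' \<subseteq> span B" by auto
        have "?E \<subseteq> span (insert g B)"
        proof
          fix f assume f: "f \<in> ?E"
          \<comment> \<open>Subtracting this multiple of \<open>g\<close> cancels the value at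
            \<open>a\<close> and keeps the zeros on \<open>A\<close>.\<close>
          have "f - (apply_bcontfun f a / apply_bcontfun g a) *\<^sub>R g \<in> ?E'"
            using f g assms(1) by (auto intro!: subspace_diff subspace_scale)
          then show "f \<in> span (insert g B)" using B(2) unfolding span_breakdown_eq by blast
        qed
        then show False using insert.IH B(1) unfolding infinite_dim_def by blast
      qed
    qed
  qed
  then have "\<not> {f \<in> E. \<forall>x\<in>A. apply_bcontfun f x = 0} \<subseteq> span {}"
    unfolding infinite_dim_def by blast
  then obtain f where f: "f \<in> E" "\<And>x. x \<in> A \<Longrightarrow> apply_bcontfun f x = 0" "f \<noteq> 0"
    by auto
  show ?thesis
  proof (intro bexI[of _ "f /\<^sub>R norm f"] conjI)
    show "f /\<^sub>R norm f \<in> E" using assms(1) f(1) by (rule subspace_scale)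
    show "f /\<^sub>R norm f \<in> unit_sphere" using f(3) by (simp add: unit_sphere_def)
  qed (simp add: f(2))
qed

text \<open>Here the selection lemma runs over functions themselves, with membership in
  \<open>E\<close> as the predicate \<open>Q\<close>; unit vectors vanishing on a finite set supply
  the choices.\<close>

lemma no_dispersed:
  assumes K: "compact (UNIV :: 'a::t2_space set)" and fin: "finite {x :: 'a. x islimpt UNIV}"
    and E: "subspace (E :: 'a CK set)" "infinite_dim E"
  shows "\<not> dispersed E"
proof -
  have sel: "\<exists>f. f \<in> E \<and> f \<in> unit_sphere \<and> (\<forall>x\<in>A. \<bar>apply_bcontfun f x\<bar> < \<epsilon>)"
    if A: "finite A" "\<epsilon> > 0" for A \<epsilon>
  proof -
    obtain f where "f \<in> E" "f \<in> unit_sphere" "\<forall>x\<in>A. apply_bcontfun f x = 0"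
      using infinite_dim_kernel[OF E A(1)] by auto
    then show ?thesis using A(2) by (intro exI[of _ f]) simp
  qed
  have "\<exists>e. (\<forall>n::nat. e n \<in> E) \<and> almost_disjoint e"
    by (rule almost_disjoint_selection[OF K fin, where Q = "\<lambda>_ p. p \<in> E" and f = "\<lambda>p. p"]) (rule sel)
  then show ?thesis unfolding dispersed_def by (rule contrapos_pn) (rule conjunct2)
qed

text \<open>Normalising moves \<open>f\<close> by the difference of the norms of \<open>e\<close>
  and \<open>f\<close>, at most \<open>norm (e - f)\<close>; the triangle inequality adds the same
  amount once more.\<close>

lemma dist_normalized:
  fixes e f :: "'a::real_normed_vector"
  assumes "norm e = 1" "f \<noteq> 0"
  shows "dist (f /\<^sub>R norm f) e \<le> 2 * norm (e - f)"
proof -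
  have "norm (f /\<^sub>R norm f - f) = norm ((1 - norm f) *\<^sub>R (f /\<^sub>R norm f))"
    using assms(2) by (simp add: algebra_simps)
  also have "\<dots> = \<bar>1 - norm f\<bar> * norm (f /\<^sub>R norm f)" by (rule norm_scaleR)
  also have "\<dots> = \<bar>norm e - norm f\<bar>" using assms by simp
  also have "\<dots> \<le> norm (e - f)" by (rule norm_triangle_ineq3)
  finally have "dist (f /\<^sub>R norm f) f \<le> norm (e - f)" by (simp add: dist_norm)
  moreover have "dist f e = norm (e - f)" by (simp add: dist_norm norm_minus_commute)
  ultimately show ?thesis using dist_triangle[of "f /\<^sub>R norm f" e f] by linarith
qed

text \<open>Two late terms of the disjoint sequence shadowing an almost disjoint sequence in
  \<open>E\<close>, once normalised, are disjoint unit vectors close to \<open>E\<close>.\<close>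

lemma dispersed_of_two_dispersed:
  assumes "two_dispersed E"
  shows "dispersed E"
proof -
  obtain r where r: "r > 0" and no: "\<not> (\<exists>f1 f2. cdisj f1 f2 \<and> f1 \<in> unit_sphere \<and> f2 \<in> unit_sphere \<and>
                     infdist f1 E < r \<and> infdist f2 E < r)"
    using assms unfolding two_dispersed_def by auto
  have False if e: "\<And>n. e n \<in> E" "almost_disjoint e" for e
  proof -
    obtain f where f: "\<And>n m. n \<noteq> m \<Longrightarrow> cdisj (f n) (f m)" "(\<lambda>n. norm (e n - f n)) \<longlonglongrightarrow> 0"
      and sph: "\<And>n. norm (e n) = 1"
      using e(2) unfolding almost_disjoint_def unit_sphere_def by blast
    have "\<forall>\<^sub>F n in sequentially. norm (e n - f n) < min 1 (r/2)"
      using order_tendstoD(2)[OF f(2), of "min 1 (r/2)"] r by simp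
    \<comment> \<open>The bound 1 keeps \<open>f n\<close> nonzero, and \<open>r/2\<close> pays for
      the factor 2 lost in normalising.\<close>
    then obtain N where N: "\<And>n. n \<ge> N \<Longrightarrow> norm (e n - f n) < min 1 (r/2)"
      unfolding eventually_sequentially by blast
    have nz: "f n \<noteq> 0" if "n \<ge> N" for n using N[OF that] sph[of n] by auto
    have near: "infdist (f n /\<^sub>R norm (f n)) E < r" if "n \<ge> N" for n
      using infdist_le[OF e(1)[of n], of "f n /\<^sub>R norm (f n)"] dist_normalized[OF sph[of n] nz[OF that]] N[OF that]
      by simp
    have "cdisj (f N /\<^sub>R norm (f N)) (f (Suc N) /\<^sub>R norm (f (Suc N)))"
      using f(1)[of N "Suc N"] by (auto simp: cdisj_iff)
    then show False using no near[of N] near[of "Suc N"] nz[of N] nz[of "Suc N"]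
      by (fastforce simp: unit_sphere_def)
  qed
  then show ?thesis using assms unfolding two_dispersed_def dispersed_def by blast
qed

section \<open>A weakly null overlapping sequence and its 2-dispersed closed span\<close>

text \<open>The points are chosen for reading off coefficients: a finite combination with
  coefficients \<open>a\<close> takes the value \<open>a n\<close> at \<open>x n\<close> and
  \<open>a n + a m / 2\<close> at \<open>v n m\<close>.\<close>

lemma overlapping_sequence:
  assumes K: "compact (UNIV :: 'a::t2_space set)" and inf: "infinite {x :: 'a. x islimpt UNIV}"
  shows "\<exists>(f :: nat \<Rightarrow> 'a CK) x v.
    (\<forall>n. x n islimpt UNIV) \<and>
    (\<forall>m n. apply_bcontfun (f m) (x n) = (if m = n then 1 else 0)) \<and>
    (\<forall>n m k. n < m \<longrightarrow> apply_bcontfun (f k) (v n m) = (if k = n then 1 else if k = m then 1/2 else 0)) \<and>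
    (\<forall>m y. 0 \<le> apply_bcontfun (f m) y) \<and>
    (\<forall>M y. (\<Sum>m<M. apply_bcontfun (f m) y) \<le> 3/2) \<and>
    (\<forall>m y. apply_bcontfun (f m) y \<le> 1)"
proof -
  obtain x :: "nat \<Rightarrow> 'a" and U where x: "\<And>n. x n islimpt UNIV" "\<And>n. open (U n)" "\<And>n. x n \<in> U n"
    and disjU: "\<And>n m. n \<noteq> m \<Longrightarrow> U n \<inter> U m = {}"
    using disjoint_neighbourhoods[OF K inf] by (metis mem_Collect_eq)
  have "\<forall>n. \<exists>g :: 'a CK. \<exists>W. open W \<and> x n \<in> W \<and> W \<subseteq> U n \<and> (\<forall>y. 0 \<le> apply_bcontfun g y \<and> apply_bcontfun g y \<le> 1)
      \<and> (\<forall>y\<in>W. apply_bcontfun g y = 1) \<and> (\<forall>y. y \<notin> U n \<longrightarrow> apply_bcontfun g y = 0)"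
    using exists_bump[OF K x(2) x(3)] by metis
  then obtain g :: "nat \<Rightarrow> 'a CK" and W where W: "\<And>n. open (W n)" "\<And>n. x n \<in> W n" "\<And>n. W n \<subseteq> U n"
    and g: "\<And>n y. 0 \<le> apply_bcontfun (g n) y" "\<And>n y. apply_bcontfun (g n) y \<le> 1"
      "\<And>n y. y \<in> W n \<Longrightarrow> apply_bcontfun (g n) y = 1" "\<And>n y. y \<notin> U n \<Longrightarrow> apply_bcontfun (g n) y = 0"
    by metis
  \<comment> \<open>As \<open>x n\<close> is not isolated, there is room in \<open>W n\<close> for
    infinitely many disjoint bumps. Removing \<open>x n\<close> makes all of them vanish there, so
    that \<open>f m\<close> keeps the values 0 and 1 at these points.\<close>
  have "infinite (W n - {x n})" for n
    using infinite_nbhd_of_islimpt[OF x(1) W(1) W(2)] by simp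
  then have "\<forall>n. \<exists>v :: nat \<Rightarrow> 'a. \<exists>V. (\<forall>m. v m \<in> W n - {x n}) \<and> (\<forall>m. open (V m)) \<and> (\<forall>m. v m \<in> V m) \<and>
      (\<forall>m m'. m \<noteq> m' \<longrightarrow> V m \<inter> V m' = {})"
    using disjoint_neighbourhoods[OF K] by metis
  then obtain v :: "nat \<Rightarrow> nat \<Rightarrow> 'a" and V where v: "\<And>n m. v n m \<in> W n - {x n}" "\<And>n m. open (V n m)"
    "\<And>n m. v n m \<in> V n m" and disjV: "\<And>n m m'. m \<noteq> m' \<Longrightarrow> V n m \<inter> V n m' = {}"
    by metis
  have "open (V n m \<inter> (W n - {x n}))" "v n m \<in> V n m \<inter> (W n - {x n})" for n m
    using v W(1) by (auto intro!: open_Int open_Diff)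
  then have "\<forall>n m. \<exists>h :: 'a CK. (\<forall>y. 0 \<le> apply_bcontfun h y \<and> apply_bcontfun h y \<le> 1)
      \<and> apply_bcontfun h (v n m) = 1 \<and> (\<forall>y. y \<notin> V n m \<inter> (W n - {x n}) \<longrightarrow> apply_bcontfun h y = 0)"
    using exists_bump[OF K] by metis
  then obtain h :: "nat \<Rightarrow> nat \<Rightarrow> 'a CK" where
    h: "\<And>n m y. 0 \<le> apply_bcontfun (h n m) y" "\<And>n m y. apply_bcontfun (h n m) y \<le> 1"
      "\<And>n m. apply_bcontfun (h n m) (v n m) = 1"
      "\<And>n m y. y \<notin> V n m \<inter> (W n - {x n}) \<Longrightarrow> apply_bcontfun (h n m) y = 0"
    by metis
  \<comment> \<open>The peaks of h j m lie in W j, where g j = 1: this makes f j and f m overlap whenever j < m.\<close>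
  define f where "f = (\<lambda>m. g m + (1/2) *\<^sub>R (\<Sum>j<m. h j m))"
  have f: "apply_bcontfun (f m) y = apply_bcontfun (g m) y + (\<Sum>j<m. apply_bcontfun (h j m) y) / 2" for m y
    by (simp add: f_def apply_bcontfun_sum)
  have gU: "apply_bcontfun (g m) y = 0" if "y \<in> U n" "m \<noteq> n" for m n y
    using disjU[OF that(2)] that(1) g(4)[of y m] by blast
  have hU: "apply_bcontfun (h j m) y = 0" if "y \<in> U n" "j \<noteq> n" for j m n y
    using disjU[OF that(2)] that(1) h(4)[of y j m] W(3)[of j] by blast
  have fU: "apply_bcontfun (f m) y = (if m = n then apply_bcontfun (g n) y else 0) +
      (if n < m then apply_bcontfun (h n m) y / 2 else 0)" if "y \<in> U n" for m n y
  proof -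
    have "(\<Sum>j<m. apply_bcontfun (h j m) y) = (\<Sum>j<m. if j = n then apply_bcontfun (h n m) y else 0)"
      by (rule sum.cong) (use hU[OF that] in auto)
    also have "\<dots> = (if n < m then apply_bcontfun (h n m) y else 0)" by simp
    finally show ?thesis using gU[OF that, of m] by (auto simp: f)
  qed
  show ?thesis
  proof (intro exI[of _ f] exI[of _ x] exI[of _ v] conjI allI impI)
    show "apply_bcontfun (f m) (x n) = (if m = n then 1 else 0)" for m n
      using fU[OF x(3), of m n] g(3)[OF W(2)] h(4)[of "x n" n m] by auto
    show "apply_bcontfun (f k) (v n m) = (if k = n then 1 else if k = m then 1/2 else 0)" if "n < m" for n m k
    proof -
      have "v n m \<in> W n" "v n m \<in> U n" using v(1)[of n m] W(3) by auto
      moreover have "apply_bcontfun (h n k) (v n m) = 0" if "k \<noteq> m"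
        using disjV[OF that, of n] v(3)[of n m] h(4)[of "v n m" n k] by blast
      ultimately show ?thesis
        using fU[of "v n m" n k] g(3)[of "v n m" n] h(3)[of n m] \<open>n < m\<close> by auto
    qed
    show "0 \<le> apply_bcontfun (f m) y" for m y
      unfolding f using g(1) h(1) by (simp add: sum_nonneg)
    show "apply_bcontfun (f m) y \<le> 1" for m y
    proof (cases "\<exists>n. y \<in> U n")
      case False
      then have "apply_bcontfun (f m) y = 0"
        unfolding f using g(4)[of y] h(4)[of y] W(3) by (subst sum.neutral) (blast, simp)
      then show ?thesis by simp
    next
      case True
      then obtain n where n: "y \<in> U n" ..
      \<comment> \<open>The cases \<open>m = n\<close> and \<open>n < m\<close> exclude each other,
        so either one \<open>g n\<close> or half a bump remains.\<close>
      show ?thesis using fU[OF n, of m] g(2)[of n y] h(2)[of n m y] by (simp split: if_splits)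
    qed
    show "(\<Sum>m<M. apply_bcontfun (f m) y) \<le> 3/2" for M y
    proof (cases "\<exists>n. y \<in> U n")
      case False
      then have "apply_bcontfun (f m) y = 0" for m
        unfolding f using g(4)[of y] h(4)[of y] W(3) by (subst sum.neutral) (blast, simp)
      then show ?thesis by simp
    next
      case True
      then obtain n where n: "y \<in> U n" ..
      \<comment> \<open>At most one of the disjoint sets \<open>V n k\<close> contains
        \<open>y\<close>, so the halved bumps add at most 1/2 to the at most 1 coming from
        \<open>g n\<close>.\<close>
      have hsum: "(\<Sum>m<M. apply_bcontfun (h n m) y) \<le> 1"
      proof (cases "\<exists>k. y \<in> V n k")
        case False
        then have "apply_bcontfun (h n m) y = 0" for m using h(4) by blast
        then show ?thesis by simp
      next
        case True
        then obtain k where k: "y \<in> V n k" ..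
        have "apply_bcontfun (h n m) y = (if m = k then apply_bcontfun (h n k) y else 0)" for m
          using disjV[of m k n] k h(4)[of y n m] by auto
        then have "(\<Sum>m<M. apply_bcontfun (h n m) y) = (\<Sum>m<M. if m = k then apply_bcontfun (h n k) y else 0)"
          by (intro sum.cong) auto
        also have "\<dots> = (if k < M then apply_bcontfun (h n k) y else 0)" by simp
        finally show ?thesis using h(2)[of n k y] by simp
      qed
      have "(\<Sum>m<M. apply_bcontfun (f m) y) \<le>
          (\<Sum>m<M. (if m = n then apply_bcontfun (g n) y else 0) + apply_bcontfun (h n m) y / 2)"
        by (rule sum_mono) (use fU[OF n] h(1) in auto)
      also have "\<dots> = (if n < M then apply_bcontfun (g n) y else 0) + (\<Sum>m<M. apply_bcontfun (h n m) y) / 2"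
        by (simp add: sum.distrib sum_divide_distrib)
      finally show ?thesis using hsum g(2)[of n y] by (auto split: if_splits)
    qed
  qed (rule x(1))
qed

text \<open>Evaluation at \<open>x n\<close> acts as the coordinate functional of
  \<open>s n\<close>, which makes the \<open>s m\<close> distinct and linearly independent.\<close>

lemma biorthogonal_not_in_finite_span:
  fixes s :: "nat \<Rightarrow> 'a::topological_space CK"
  assumes s: "\<And>m n. apply_bcontfun (s m) (x n) = (if m = n then 1 else 0)"
  shows "\<not> (\<exists>B. finite B \<and> range s \<subseteq> span B)"
proof
  assume "\<exists>B. finite B \<and> range s \<subseteq> span B"
  then obtain B where B: "finite B" "range s \<subseteq> span B" by auto
  have inj: "inj s" using s by (metis injI zero_neq_one)
  have "independent (range s)"
    unfolding independent_explicit_module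
  proof (intro allI impI)
    fix t u w assume t: "finite t" "t \<subseteq> range s" "(\<Sum>w\<in>t. u w *\<^sub>R w) = 0" "w \<in> t"
    then obtain n where n: "w = s n" by auto
    have "0 = apply_bcontfun (\<Sum>w\<in>t. u w *\<^sub>R w) (x n)" using t by simp
    also have "\<dots> = (\<Sum>w'\<in>t. if w' = w then u w else 0)"
      unfolding apply_bcontfun_sum
    proof (rule sum.cong)
      fix w' assume "w' \<in> t"
      then obtain m where "w' = s m" using t by auto
      then show "apply_bcontfun (u w' *\<^sub>R w') (x n) = (if w' = w then u w else 0)"
        using s[of m n] inj by (auto simp: n inj_eq)
    qed simp
    also have "\<dots> = u w" using t by simp
    finally show "u w = 0" by simp
  qed
  then have "finite (range s)" using independent_span_bound[OF B(1) _ B(2)] by blast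
  then show False using inj finite_imageD by blast
qed

text \<open>By positivity, partial sums with arbitrary signs stay bounded by \<open>C\<close>.
  Choosing the signs of \<open>\<phi> (f m)\<close> bounds the sums of the
  \<open>\<bar>\<phi> (f m)\<bar>\<close>, so that series converges and its terms tend to 0.\<close>

lemma functional_null_of_bounded_sums:
  fixes f :: "nat \<Rightarrow> 'a::topological_space CK"
  assumes pos: "\<And>m y. 0 \<le> apply_bcontfun (f m) y"
    and bd: "\<And>M y. (\<Sum>m<M. apply_bcontfun (f m) y) \<le> C"
    and \<phi>: "bounded_linear \<phi>"
  shows "(\<lambda>m. \<bar>\<phi> (f m)\<bar> :: real) \<longlonglongrightarrow> 0"
proof -
  obtain B where B: "\<And>f. norm (\<phi> f) \<le> norm f * B" "B > 0"
    using bounded_linear.pos_bounded[OF \<phi>] by blast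
  have "(\<Sum>m<M. \<bar>\<phi> (f m)\<bar>) \<le> C * B" for M
  proof -
    define g where "g = (\<Sum>m<M. sgn (\<phi> (f m)) *\<^sub>R f m)"
    have "norm g \<le> C"
    proof (rule norm_bound)
      fix y
      have "norm (apply_bcontfun g y) \<le> (\<Sum>m<M. \<bar>sgn (\<phi> (f m)) * apply_bcontfun (f m) y\<bar>)"
        by (simp add: g_def apply_bcontfun_sum)
      also have "\<dots> \<le> (\<Sum>m<M. apply_bcontfun (f m) y)"
        by (rule sum_mono) (use pos in \<open>auto simp: abs_mult abs_sgn_eq\<close>)
      finally show "norm (apply_bcontfun g y) \<le> C" using bd[where y = y and M = M] by simp
    qed
    have "(\<Sum>m<M. \<bar>\<phi> (f m)\<bar>) = \<phi> g"
      unfolding g_def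
      by (simp add: linear_sum[OF bounded_linear.linear[OF \<phi>]] linear_scale[OF bounded_linear.linear[OF \<phi>]]
          sgn_mult_self_eq mult.commute abs_sgn)
    also have "\<dots> \<le> norm g * B" using B(1)[of g] by simp
    also have "\<dots> \<le> C * B" using \<open>norm g \<le> C\<close> B(2) by simp
    finally show ?thesis .
  qed
  then have "summable (\<lambda>m. \<bar>\<phi> (f m)\<bar>)"
    by (intro bounded_imp_summable[where B = "C * B"]) (auto simp: lessThan_Suc_atMost[symmetric] simp del: sum.lessThan_Suc)
  then show ?thesis by (rule summable_LIMSEQ_zero)
qed

lemma subspace_closure:
  fixes S :: "'a::real_normed_vector set"
  assumes "subspace S"
  shows "subspace (closure S)"
proof (rule subspaceI)
  show "0 \<in> closure S" using subspace_0[OF assms] closure_subset by blast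
next
  fix x y assume "x \<in> closure S" "y \<in> closure S"
  then obtain u v where "\<And>n. u n \<in> S" "u \<longlonglongrightarrow> x" "\<And>n. v n \<in> S" "v \<longlonglongrightarrow> y"
    unfolding closure_sequential by blast
  then have "(\<forall>n. u n + v n \<in> S) \<and> (\<lambda>n. u n + v n) \<longlonglongrightarrow> x + y"
    using subspace_add[OF assms] tendsto_add by blast
  then show "x + y \<in> closure S" unfolding closure_sequential by (intro exI)
next
  fix c x assume "x \<in> closure S"
  then obtain u where "\<And>n. u n \<in> S" "u \<longlonglongrightarrow> x"
    unfolding closure_sequential by blast
  then have "(\<forall>n. c *\<^sub>R u n \<in> S) \<and> (\<lambda>n. c *\<^sub>R u n) \<longlonglongrightarrow> c *\<^sub>R x"
    using subspace_scale[OF assms] tendsto_scaleR[OF tendsto_const] by blast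
  then show "c *\<^sub>R x \<in> closure S" unfolding closure_sequential by (intro exI)
qed

lemma two_dispersed_span:
  fixes f :: "nat \<Rightarrow> 'a::topological_space CK"
  assumes fx: "\<And>m n. apply_bcontfun (f m) (x n) = (if m = n then 1 else 0)"
    and fv: "\<And>n m k. n < m \<Longrightarrow> apply_bcontfun (f k) (v n m) = (if k = n then 1 else if k = m then 1/2 else 0)"
    and pos: "\<And>m y. 0 \<le> apply_bcontfun (f m) y"
    and bd: "\<And>M y. (\<Sum>m<M. apply_bcontfun (f m) y) \<le> 3/2"
  shows "two_dispersed (closure (span (range f)))"
proof -
  \<comment> \<open>Say the largest coefficients of e1 and e2 are a n and b m with n < m. Then e1 is at least |a n| / 2 in
    modulus at both x n and v n m, while the values of e2 there differ by b m / 2.\<close>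
  have span: "\<exists>a M. e = (\<Sum>m<M. a m *\<^sub>R f m)" if "e \<in> span (range f)" for e
    using that
  proof (induction rule: span_induct_alt)
    case base
    show ?case by (rule exI, rule exI[of _ 0]) simp
  next
    case (step c w y)
    then obtain k a M where w: "w = f k" and y: "y = (\<Sum>m<M. a m *\<^sub>R f m)" by auto
    \<comment> \<open>The length \<open>M + Suc k\<close> covers both the old coefficients, padded
      with zeros, and the index \<open>k\<close>.\<close>
    define a' where "a' = (\<lambda>m. (if m = k then c else 0) + (if m < M then a m else 0))"
    have "(\<Sum>m<M + Suc k. a' m *\<^sub>R f m) =
      (\<Sum>m<M + Suc k. (if m = k then c *\<^sub>R f k else 0)) + (\<Sum>m<M + Suc k. (if m < M then a m *\<^sub>R f m else 0))"
      unfolding sum.distrib[symmetric] by (rule sum.cong) (auto simp: a'_def algebra_simps)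
    also have "(\<Sum>m<M + Suc k. (if m < M then a m *\<^sub>R f m else 0)) = y"
      unfolding y by (rule sum.mono_neutral_cong_right) auto
    finally have "c *\<^sub>R w + y = (\<Sum>m<M + Suc k. a' m *\<^sub>R f m)" by (simp add: w)
    then show ?case by blast
  qed
  \<comment> \<open>A unit vector within 1/8 of \<open>e\<close> forces
    \<open>7/8 \<le> norm e\<close>. Since the norm is at most 3/2 times the largest coefficient,
    that coefficient is at least 7/12. If \<open>e2\<close> is below a quarter of this, 7/48, at
    \<open>x n\<close>, then it is at least 7/24 - 7/48 = 7/48 at \<open>v n m\<close>.\<close>
  have overlap: "\<exists>y. 7/48 \<le> \<bar>apply_bcontfun e1 y\<bar> \<and> 7/48 \<le> \<bar>apply_bcontfun e2 y\<bar>"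
    if e: "e1 \<in> span (range f)" "e2 \<in> span (range f)" "7/8 \<le> norm e1" "7/8 \<le> norm e2" for e1 e2
  proof -
    have big: "\<exists>n. 7/12 \<le> \<bar>apply_bcontfun e (x n)\<bar> \<and> (\<forall>m. \<bar>apply_bcontfun e (x m)\<bar> \<le> \<bar>apply_bcontfun e (x n)\<bar>)" if es: "e \<in> span (range f)" "7/8 \<le> norm e" for e
    proof -
      obtain a M where e: "e = (\<Sum>m<M. a m *\<^sub>R f m)" using span[OF es(1)] by blast
      have ex: "apply_bcontfun e (x n) = (if n < M then a n else 0)" for n
        by (simp add: e apply_bcontfun_sum fx if_distrib[of "(*) _"] cong: if_cong)
      have M: "M > 0" using es(2) by (cases M) (auto simp: e)
      define A where "A = Max ((\<lambda>m. \<bar>a m\<bar>) ` {..<M})"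
      have "A \<in> (\<lambda>m. \<bar>a m\<bar>) ` {..<M}" unfolding A_def by (rule Max_in) (use M in auto)
      then obtain n where n: "n < M" "A = \<bar>a n\<bar>" by auto
      have le: "\<bar>a m\<bar> \<le> A" if "m < M" for m unfolding A_def using that by simp
      have "norm e \<le> A * (3/2)"
      proof (rule norm_bound)
        fix y
        have "norm (apply_bcontfun e y) \<le> (\<Sum>m<M. \<bar>a m * apply_bcontfun (f m) y\<bar>)"
          by (simp add: e apply_bcontfun_sum)
        also have "\<dots> \<le> (\<Sum>m<M. A * apply_bcontfun (f m) y)"
          by (rule sum_mono) (use pos le in \<open>auto simp: abs_mult intro!: mult_right_mono\<close>)
        also have "\<dots> \<le> A * (3/2)"
          unfolding sum_distrib_left[symmetric] using bd n(2) by (intro mult_left_mono) auto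
        finally show "norm (apply_bcontfun e y) \<le> A * (3/2)" .
      qed
      then have "7/12 \<le> A" using es(2) by simp
      then show ?thesis using n le by (intro exI[of _ n]) (auto simp: ex)
    qed
    have ev: "apply_bcontfun e (v n m) = apply_bcontfun e (x n) + apply_bcontfun e (x m) / 2"
      if es: "e \<in> span (range f)" and "n < m" for e n m
    proof -
      obtain a M where e: "e = (\<Sum>m<M. a m *\<^sub>R f m)" using span[OF es(1)] by blast
      show ?thesis
        unfolding e apply_bcontfun_sum sum_divide_distrib sum.distrib[symmetric]
        by (rule sum.cong) (use \<open>n < m\<close> in \<open>auto simp: fx fv\<close>)
    qed
    obtain n where n: "7/12 \<le> \<bar>apply_bcontfun e1 (x n)\<bar>" "\<And>k. \<bar>apply_bcontfun e1 (x k)\<bar> \<le> \<bar>apply_bcontfun e1 (x n)\<bar>"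
      using big[OF e(1,3)] by blast
    obtain m where m: "7/12 \<le> \<bar>apply_bcontfun e2 (x m)\<bar>" "\<And>k. \<bar>apply_bcontfun e2 (x k)\<bar> \<le> \<bar>apply_bcontfun e2 (x m)\<bar>"
      using big[OF e(2,4)] by blast
    consider "n = m" | "n < m" | "m < n" by linarith
    then show ?thesis
    proof cases
      case 1
      then show ?thesis using n(1) m(1) by (intro exI[of _ "x n"]) auto
    next
      case 2
      show ?thesis
      proof (cases "7/48 \<le> \<bar>apply_bcontfun e2 (x n)\<bar>")
        case True
        then show ?thesis using n(1) by (intro exI[of _ "x n"]) auto
      next
        case False
        then show ?thesis
          using n(1) m(1) n(2)[of m] ev[OF e(1) 2] ev[OF e(2) 2]
          by (intro exI[of _ "v n m"] conjI) linarith+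
      qed
    next
      case 3
      show ?thesis
      proof (cases "7/48 \<le> \<bar>apply_bcontfun e1 (x m)\<bar>")
        case True
        then show ?thesis using m(1) by (intro exI[of _ "x m"]) auto
      next
        case False
        then show ?thesis
          using n(1) m(1) m(2)[of n] ev[OF e(1) 3] ev[OF e(2) 3]
          by (intro exI[of _ "v m n"] conjI) linarith+
      qed
    qed
  qed
  have approx: "\<exists>e\<in>span (range f). norm (g - e) < 1/8" if "infdist g (closure (span (range f))) < 1/8" for g
  proof -
    have ne: "closure (span (range f)) \<noteq> {}" using closure_subset[of "span (range f)"] span_zero[of "range f"] by blast
    have "\<exists>e'\<in>closure (span (range f)). dist g e' < 1/8"
    proof -
      have "bdd_below (dist g ` closure (span (range f)))" by (rule bdd_belowI[of _ 0]) auto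
      then show ?thesis using that cINF_less_iff[OF ne, of "dist g" "1/8"] ne by (simp add: infdist_notempty)
    qed
    then obtain e' where e': "e' \<in> closure (span (range f))" "dist g e' < 1/8" by blast
    \<comment> \<open>The slack left under 1/8 absorbs the passage from the closure to the span
      itself.\<close>
    then obtain e where e: "e \<in> span (range f)" "dist e e' < 1/8 - dist g e'"
      using closure_approachable[THEN iffD1, rule_format, OF e'(1), of "1/8 - dist g e'"] by auto
    then have "dist g e < 1/8" using dist_triangle[of g e e'] by (simp add: dist_commute)
    then show ?thesis using e(1) by (auto simp: dist_norm)
  qed
  have no: "\<not> (\<exists>f1 f2. cdisj f1 f2 \<and> f1 \<in> unit_sphere \<and> f2 \<in> unit_sphere \<and>
      infdist f1 (closure (span (range f))) < 1/8 \<and> infdist f2 (closure (span (range f))) < 1/8)"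
  proof
    assume "\<exists>f1 f2. cdisj f1 f2 \<and> f1 \<in> unit_sphere \<and> f2 \<in> unit_sphere \<and>
      infdist f1 (closure (span (range f))) < 1/8 \<and> infdist f2 (closure (span (range f))) < 1/8"
    then obtain f1 f2 e1 e2 where d: "cdisj f1 f2" and n: "norm f1 = 1" "norm f2 = 1"
      and e: "e1 \<in> span (range f)" "e2 \<in> span (range f)" "norm (f1 - e1) < 1/8" "norm (f2 - e2) < 1/8"
      using approx unfolding unit_sphere_def by blast
    have "7/8 \<le> norm e1" "7/8 \<le> norm e2"
      using n e norm_triangle_ineq2[of f1 e1] norm_triangle_ineq2[of f2 e2] by linarith+
    from overlap[OF e(1,2) this] obtain y where
      y: "7/48 \<le> \<bar>apply_bcontfun e1 y\<bar>" "7/48 \<le> \<bar>apply_bcontfun e2 y\<bar>" by auto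
    \<comment> \<open>This uses that 7/48 exceeds the approximation error 1/8.\<close>
    have "apply_bcontfun f1 y \<noteq> 0" "apply_bcontfun f2 y \<noteq> 0"
      using y e(3,4) abs_apply_le_norm[of "f1 - e1" y] abs_apply_le_norm[of "f2 - e2" y] by auto
    then show False using d unfolding cdisj_iff by blast
  qed
  have "closed_subspace (closure (span (range f)))"
    using subspace_closure[OF subspace_span] by (simp add: closed_subspace_def)
  then show ?thesis
    unfolding two_dispersed_def by (rule conjI[OF _ exI[of _ "1/8"]], intro conjI no) simp
qed

section \<open>The order continuous part and its codimension\<close>

text \<open>Order continuity on the ideal is a Dini argument: elements below a fixed
  \<open>d0\<close> are small off a finite set of isolated points, where directedness makes them
  small as well. Any ideal with a member not vanishing at a non-isolated point fails the
  condition.\<close>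

lemma oc_part_eq:
  assumes K: "compact (UNIV :: 'a::t2_space set)"
  shows "(oc_part :: 'a CK set) = {f. \<forall>x. x islimpt UNIV \<longrightarrow> apply_bcontfun f x = 0}" (is "_ = ?I")
proof -
  have ideal: "is_ideal ?I"
    unfolding is_ideal_def
  proof (intro conjI allI impI)
    show "subspace ?I" by (auto simp: subspace_def)
    fix f g assume "f \<in> ?I \<and> cle (cabs g) (cabs f)"
    then have "\<forall>x. x islimpt UNIV \<longrightarrow> apply_bcontfun f x = 0"
      "\<forall>x. \<bar>apply_bcontfun g x\<bar> \<le> \<bar>apply_bcontfun f x\<bar>" by (auto simp: cle_def)
    then have "apply_bcontfun g x = 0" if "x islimpt UNIV" for x
      using that by (metis abs_0 abs_le_zero_iff)
    then show "g \<in> ?I" by blast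
  qed
  have oc: "order_cont_on ?I"
    unfolding order_cont_on_def
  proof (intro allI impI, elim conjE)
    fix D assume D: "D \<subseteq> ?I" "D \<noteq> {}" "\<forall>d1\<in>D. \<forall>d2\<in>D. \<exists>d\<in>D. cle d d1 \<and> cle d d2"
      "\<forall>d\<in>D. cle 0 d" "\<forall>h. (\<forall>d\<in>D. cle h d) \<longrightarrow> cle h 0"
    have pos: "0 \<le> apply_bcontfun d y" if "d \<in> D" for d y using D(4) that by (auto simp: cle_def)
    \<comment> \<open>Otherwise \<epsilon> times the indicator of \<open>{x}\<close>, continuous as
      \<open>x\<close> is isolated, would be a lower bound of \<open>D\<close> that is not below
      0.\<close>
    have small: "\<exists>d\<in>D. apply_bcontfun d x < \<epsilon>" if x: "\<not> x islimpt UNIV" and "\<epsilon> > 0" for x \<epsilon>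
    proof (rule ccontr)
      assume "\<not> ?thesis"
      then have le: "\<And>d. d \<in> D \<Longrightarrow> \<epsilon> \<le> apply_bcontfun d x" by (auto simp: not_less)
      obtain h :: "'a CK" where h: "\<And>y. apply_bcontfun h y = (if y \<in> {x} then apply_bcontfun (const_bcontfun \<epsilon> :: 'a CK) y else 0)"
        using restrict_to_isolated[of "{x}"] x by blast
      have "cle h d" if "d \<in> D" for d using le[OF that] pos[OF that] by (auto simp: cle_def h)
      then have "cle h 0" using D(5) by blast
      then have "apply_bcontfun h x \<le> 0" by (simp add: cle_def)
      then show False using \<open>\<epsilon> > 0\<close> by (simp add: h)
    qed
    have "\<exists>d\<in>D. norm d \<le> \<epsilon>" if \<epsilon>: "\<epsilon> > 0" for \<epsilon>
    proof -
      obtain d0 where d0: "d0 \<in> D" using D(2) by blast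
      \<comment> \<open>Since \<open>d0\<close> vanishes at the non-isolated points,
        \<open>F\<close> is closed and consists of isolated points. Off \<open>F\<close> every
        element below \<open>d0\<close> is already under \<epsilon>.\<close>
      define F where "F = {x. \<epsilon> \<le> \<bar>apply_bcontfun d0 x\<bar>}"
      have iso: "\<not> x islimpt UNIV" if "x \<in> F" for x
        using that d0 D(1) \<epsilon> by (auto simp: F_def)
      have "finite F"
        by (rule finite_closed_isolated[OF K]) (use iso in \<open>auto simp: F_def closed_level_set\<close>)
      have "\<exists>d\<in>D. cle d d0 \<and> (\<forall>x\<in>A. apply_bcontfun d x < \<epsilon>)" if "finite A" "A \<subseteq> F" for A
        using that
      proof (induction A)
        case empty
        then show ?case using d0 by (auto simp: cle_def)
      next
        case (insert a A)
        then obtain d where d: "d \<in> D" "cle d d0" "\<forall>x\<in>A. apply_bcontfun d x < \<epsilon>" by auto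
        obtain d' where d': "d' \<in> D" "apply_bcontfun d' a < \<epsilon>" using small[OF iso \<epsilon>] insert by blast
        obtain d'' where d'': "d'' \<in> D" "cle d'' d" "cle d'' d'" using D(3) d d' by blast
        then have le: "apply_bcontfun d'' x \<le> apply_bcontfun d x" "apply_bcontfun d'' x \<le> apply_bcontfun d' x" for x
          by (auto simp: cle_def)
        have "cle d'' d0" using le(1) d(2) unfolding cle_def by (meson order_trans)
        moreover have "\<forall>x\<in>insert a A. apply_bcontfun d'' x < \<epsilon>"
          using le d(3) d'(2) by (auto intro: le_less_trans)
        ultimately show ?case using d''(1) by blast
      qed
      then obtain d where d: "d \<in> D" "cle d d0" "\<forall>x\<in>F. apply_bcontfun d x < \<epsilon>"
        using \<open>finite F\<close> by blast
      have "norm (apply_bcontfun d x) \<le> \<epsilon>" for x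
      proof (cases "x \<in> F")
        case True
        then show ?thesis using d(3) pos[OF d(1), of x] by force
      next
        case False
        then show ?thesis using d(2) pos[OF d(1), of x] unfolding cle_def F_def
          by (smt (verit) mem_Collect_eq real_norm_def)
      qed
      then show ?thesis using d(1) norm_bound by blast
    qed
    then have "(INF d\<in>D. norm d) \<le> \<epsilon>" if "\<epsilon> > 0" for \<epsilon>
      using that by (meson bdd_belowI2 cINF_lower2 norm_ge_zero)
    then have "(INF d\<in>D. norm d) \<le> 0" by (rule field_le_epsilon[where y = 0, simplified])
    moreover have "0 \<le> (INF d\<in>D. norm d)" using D(2) by (intro cINF_greatest) auto
    ultimately show "(INF d\<in>D. norm d) = 0" by simp
  qed
  have maximal: "J \<subseteq> ?I" if J: "is_ideal J" "order_cont_on J" for J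
  proof (rule ccontr)
    assume "\<not> J \<subseteq> ?I"
    then obtain f x where f: "f \<in> J" "x islimpt UNIV" "apply_bcontfun f x \<noteq> 0" by auto
    \<comment> \<open>As x is not isolated, D decreases to 0, although all its elements have norm at least |f x|.\<close>
    define D where "D = {g. cle 0 g \<and> cle g (cabs f) \<and> apply_bcontfun g x = \<bar>apply_bcontfun f x\<bar>}"
    have "D \<subseteq> J"
    proof
      fix g assume "g \<in> D"
      then have "cle (cabs g) (cabs f)" by (auto simp: D_def cle_def)
      then show "g \<in> J" using J(1) f(1) unfolding is_ideal_def by blast
    qed
    moreover have ne: "D \<noteq> {}" by (auto simp: D_def cle_def intro!: exI[of _ "cabs f"])
    moreover have "\<exists>d\<in>D. cle d d1 \<and> cle d d2" if d12: "d1 \<in> D" "d2 \<in> D" for d1 d2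
    proof -
      have "continuous_on UNIV (\<lambda>y. min (apply_bcontfun d1 y) (apply_bcontfun d2 y))"
        by (intro continuous_intros) auto
      from bcontfun_of_continuous[OF K this] obtain d :: "'a CK" where
        "\<And>y. apply_bcontfun d y = min (apply_bcontfun d1 y) (apply_bcontfun d2 y)" by blast
      then show ?thesis using d12 by (intro bexI[of _ d]) (auto simp: D_def cle_def min_le_iff_disj)
    qed
    moreover have "\<forall>d\<in>D. cle 0 d" by (simp add: D_def)
    moreover have "cle h 0" if h: "\<forall>d\<in>D. cle h d" for h
    proof -
      \<comment> \<open>Multiplying the modulus of \<open>f\<close> by a bump that is 1 at
        \<open>x\<close> and 0 at \<open>y\<close> gives a member of \<open>D\<close> vanishing at
        \<open>y\<close>.\<close>
      have off: "apply_bcontfun h y \<le> 0" if "y \<noteq> x" for y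
      proof -
        obtain \<phi> :: "'a CK" and W where \<phi>: "x \<in> W" "\<And>y. 0 \<le> apply_bcontfun \<phi> y" "\<And>y. apply_bcontfun \<phi> y \<le> 1"
          "\<And>y. y \<in> W \<Longrightarrow> apply_bcontfun \<phi> y = 1" "\<And>z. z \<notin> - {y} \<Longrightarrow> apply_bcontfun \<phi> z = 0"
          by (rule exists_bump[OF K, of "-{y}" x]) (use \<open>y \<noteq> x\<close> in \<open>auto simp: open_Compl\<close>)
        have "continuous_on UNIV (\<lambda>z. apply_bcontfun \<phi> z * \<bar>apply_bcontfun f z\<bar>)"
          by (intro continuous_intros) auto
        from bcontfun_of_continuous[OF K this] obtain d :: "'a CK" where
          d: "\<And>z. apply_bcontfun d z = apply_bcontfun \<phi> z * \<bar>apply_bcontfun f z\<bar>" by blast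
        have "d \<in> D"
          using \<phi> by (auto simp: D_def cle_def d intro!: mult_left_le_one_le)
        then have "apply_bcontfun h y \<le> apply_bcontfun d y" using h by (auto simp: cle_def)
        then show ?thesis using \<phi>(5)[of y] by (simp add: d)
      qed
      have "apply_bcontfun h x \<le> 0"
      proof (rule ccontr)
        assume "\<not> apply_bcontfun h x \<le> 0"
        \<comment> \<open>A lower bound positive at \<open>x\<close> would be positive only there,
          making \<open>{x}\<close> open.\<close>
        then have "{y. 0 < apply_bcontfun h y} = {x}" using off by (auto simp: not_le[symmetric])
        moreover have "open {y. 0 < apply_bcontfun h y}" by (intro open_Collect_less continuous_intros) auto
        ultimately show False using f(2) by (simp add: islimpt_UNIV_iff)
      qed
      then show ?thesis using off unfolding cle_def by (metis zero_bcontfun.rep_eq)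
    qed
    ultimately have "(INF d\<in>D. norm d) = 0"
      using J(2)[unfolded order_cont_on_def, rule_format, of D] by blast
    moreover have "\<bar>apply_bcontfun f x\<bar> \<le> (INF d\<in>D. norm d)"
    proof (rule cINF_greatest[OF ne])
      fix g assume "g \<in> D"
      then show "\<bar>apply_bcontfun f x\<bar> \<le> norm g"
        using abs_apply_le_norm[of g x] by (simp add: D_def)
    qed
    ultimately show False using f(3) by simp
  qed
  show ?thesis
    unfolding oc_part_def
    by (rule the_equality) (use ideal oc maximal in \<open>blast+\<close>)
qed

text \<open>Each further point costs at most one extra vector \<open>g\<close> in the
  complement.\<close>

lemma finite_codim_vanishing:
  assumes "finite A"
  shows "finite_codim {f :: 'a::topological_space CK. \<forall>x\<in>A. apply_bcontfun f x = 0}"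
  using assms
proof induction
  case empty
  show ?case by (auto simp: finite_codim_def)
next
  case (insert a A)
  let ?E = "{f :: 'a CK. \<forall>x\<in>A. apply_bcontfun f x = 0}"
  let ?E' = "{f :: 'a CK. \<forall>x\<in>insert a A. apply_bcontfun f x = 0}"
  obtain S where S: "finite S" "span (?E \<union> S) = UNIV" using insert.IH by (auto simp: finite_codim_def)
  obtain g where g: "?E \<subseteq> span (insert g ?E')"
  proof (cases "\<exists>g\<in>?E. apply_bcontfun g a \<noteq> 0")
    case False
    then have "?E \<subseteq> ?E'" by auto
    \<comment> \<open>If evaluation at \<open>a\<close> already vanishes on the old space, the zero
      vector serves as \<open>g\<close>.\<close>
    then show ?thesis using that[of 0] by (meson order_trans span_superset subset_insertI)
  next
    case True
    then obtain g where g: "g \<in> ?E" "apply_bcontfun g a \<noteq> 0" by auto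
    show ?thesis
    proof (rule that[of g], rule subsetI)
      fix f assume f: "f \<in> ?E"
      have "f - (apply_bcontfun f a / apply_bcontfun g a) *\<^sub>R g \<in> ?E'" using f g by auto
      then show "f \<in> span (insert g ?E')" unfolding span_breakdown_eq by (blast intro: span_base[of _ ?E'])
    qed
  qed
  have "?E \<union> S \<subseteq> span (?E' \<union> insert g S)"
    using g span_mono[of "insert g ?E'" "?E' \<union> insert g S"] span_superset[of "?E' \<union> insert g S"] by auto
  then have "span (?E' \<union> insert g S) = UNIV"
    using S(2) span_minimal[OF _ subspace_span] by blast
  then show ?case unfolding finite_codim_def using S(1) by blast
qed

text \<open>Modulo the subspace, each \<open>s m\<close> equals some \<open>t m\<close> in the span
  of \<open>S\<close> with the same values at the points \<open>x n\<close>, so a finite-dimensional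
  space would contain a biorthogonal sequence.\<close>

lemma not_finite_codim_vanishing:
  fixes s :: "nat \<Rightarrow> 'a::topological_space CK"
  assumes s: "\<And>m n. apply_bcontfun (s m) (x n) = (if m = n then 1 else 0)"
  shows "\<not> finite_codim {f :: 'a CK. \<forall>y\<in>A \<union> range x. apply_bcontfun f y = 0}" (is "\<not> finite_codim ?I")
proof
  assume "finite_codim ?I"
  then obtain S where S: "finite S" "span (?I \<union> S) = UNIV" by (auto simp: finite_codim_def)
  have "subspace ?I" by (auto simp: subspace_def)
  then have I: "span ?I = ?I" by (simp add: span_eq_iff)
  have "\<forall>m. \<exists>t. t \<in> span S \<and> s m - t \<in> ?I"
  proof
    fix m
    have "s m \<in> span (?I \<union> S)" using S by simp
    then obtain i t where "s m = i + t" "i \<in> ?I" "t \<in> span S" unfolding span_Un I by blast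
    then show "\<exists>t. t \<in> span S \<and> s m - t \<in> ?I" by (intro exI[of _ t]) simp
  qed
  from choice[OF this] obtain t where t: "\<And>m. t m \<in> span S" "\<And>m. s m - t m \<in> ?I" by blast
  have "apply_bcontfun (t m) (x n) = (if m = n then 1 else 0)" for m n
    using t(2)[of m] s[of m n] by auto
  from biorthogonal_not_in_finite_span[OF this] show False using S(1) t(1) by blast
qed

section \<open>Counterexamples for infinitely many non-isolated points, and the equivalences\<close>

text \<open>A bad sequence is turned into a net over the index type \<open>'p\<close> by copying the
  order of the natural numbers along an injection. The chosen indices need not increase, so every
  selection \<open>p\<close> has to be excluded.\<close>

lemma not_KP_of_seq:
  assumes inf: "infinite (UNIV :: 'p set)"
    and f: "\<And>n. f n \<in> unit_sphere" "tau_null_seq Ns f"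
    and no: "\<And>p :: nat \<Rightarrow> nat. \<not> almost_disjoint (f \<circ> p)"
  shows "\<not> KP_property Ns TYPE('p)"
proof
  assume KP: "KP_property Ns TYPE('p)"
  obtain i :: "nat \<Rightarrow> 'p" where i: "inj i" using infinite_countable_subset[OF inf] by blast
  define le where "le = (\<lambda>p q. inv i p \<le> inv i q)"
  have [simp]: "inv i (i n) = n" for n using i by simp
  have "directed_set (range i) le"
    by (simp add: directed_set_def le_def) (meson nat_le_linear order_refl order_trans)
  moreover have "tau_null_net Ns (range i) le (f \<circ> inv i)"
    using f(2) unfolding tau_null_net_def tau_null_seq_def net_null_def LIMSEQ_iff le_def by simp
  ultimately obtain pn where "almost_disjoint ((f \<circ> inv i) \<circ> pn)"
    using KP[unfolded KP_property_def, rule_format, of "range i" le "f \<circ> inv i" i] f(1) by auto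
  then show False using no[of "inv i \<circ> pn"] by (simp add: comp_assoc)
qed

lemma infinite_nonisolated_counterexamples:
  assumes K: "compact (UNIV :: 'a::t2_space set)" and inf: "infinite {x :: 'a. x islimpt UNIV}"
  shows "\<not> finite_codim (oc_part :: 'a CK set)"
    and "\<exists>E :: 'a CK set. infinite_dim E \<and> two_dispersed E"
    and "\<exists>f :: nat \<Rightarrow> 'a CK. (\<forall>n. f n \<in> unit_sphere) \<and> tau_null_seq (weak_sn \<union> abs_weak_sn) f \<and>
      (\<forall>p :: nat \<Rightarrow> nat. \<not> almost_disjoint (f \<circ> p))"
proof -
  obtain f :: "nat \<Rightarrow> 'a CK" and x v where f':
    "\<forall>n. x n islimpt UNIV"
    "\<forall>m n. apply_bcontfun (f m) (x n) = (if m = n then 1 else 0)"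
    "\<forall>n m k. n < m \<longrightarrow> apply_bcontfun (f k) (v n m) = (if k = n then 1 else if k = m then 1/2 else 0)"
    "\<forall>m y. 0 \<le> apply_bcontfun (f m) y"
    "\<forall>M y. (\<Sum>m<M. apply_bcontfun (f m) y) \<le> 3/2"
    "\<forall>m y. apply_bcontfun (f m) y \<le> 1"
    using overlapping_sequence[OF K inf] by (elim exE conjE) (rule that)
  note f = f'[rule_format]
  have "{f :: 'a CK. \<forall>x. x islimpt UNIV \<longrightarrow> apply_bcontfun f x = 0} =
      {f. \<forall>y\<in>{x. x islimpt UNIV} \<union> range x. apply_bcontfun f y = 0}" using f(1) by auto
  then show "\<not> finite_codim (oc_part :: 'a CK set)"
    using not_finite_codim_vanishing[OF f(2)] by (simp add: oc_part_eq[OF K])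
  define E where "E = closure (span (range f))"
  have E: "two_dispersed E" unfolding E_def by (rule two_dispersed_span[OF f(2-5)])
  have fE: "f n \<in> E" for n
    unfolding E_def using closure_subset[of "span (range f)"] span_base[of "f n" "range f"] by auto
  have "infinite_dim E"
    unfolding infinite_dim_def
  proof
    assume "\<exists>B. finite B \<and> E \<subseteq> span B"
    then obtain B where "finite B" "E \<subseteq> span B" by auto
    then have "finite B \<and> range f \<subseteq> span B" using fE by auto
    then have "\<exists>B. finite B \<and> range f \<subseteq> span B" by (rule exI)
    then show False by (rule notE[OF biorthogonal_not_in_finite_span[OF f(2)]])
  qed
  then show "\<exists>E :: 'a CK set. infinite_dim E \<and> two_dispersed E"
    using E by (intro exI[of _ E] conjI)
  have "norm (f n) = 1" for n
  proof (rule antisym)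
    show "norm (f n) \<le> 1"
    proof (rule norm_bound)
      show "norm (apply_bcontfun (f n) y) \<le> 1" for y using f(4,6) by simp
    qed
    show "1 \<le> norm (f n)" using abs_apply_le_norm[of "f n" "x n"] f(2) by simp
  qed
  then have sph: "f n \<in> unit_sphere" for n by (simp add: unit_sphere_def)
  \<comment> \<open>By positivity the absolute weak seminorms reduce to plain functionals on this
    sequence, so one summability argument covers both families.\<close>
  have "cabs (f n) = f n" for n by (rule bcontfun_eqI) (simp add: f(4))
  moreover have "(\<lambda>n. \<nu> (f n)) \<longlonglongrightarrow> 0" if "bounded_linear \<nu>" for \<nu> :: "'a CK \<Rightarrow> real"
    using functional_null_of_bounded_sums[OF f(4,5) that] by (simp add: tendsto_rabs_zero_iff)
  ultimately have "tau_null_seq (weak_sn \<union> abs_weak_sn) f"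
    by (auto simp: tau_null_seq_def weak_sn_def abs_weak_sn_def positive_functional_def tendsto_rabs_zero_iff)
  \<comment> \<open>Every selection stays inside \<open>E\<close>, which is dispersed because it is
    2-dispersed.\<close>
  moreover have "\<not> almost_disjoint (f \<circ> p)" for p :: "nat \<Rightarrow> nat"
  proof
    assume "almost_disjoint (f \<circ> p)"
    moreover have "\<forall>n. (f \<circ> p) n \<in> E" by (simp add: fE)
    ultimately have "\<exists>e. (\<forall>n. e n \<in> E) \<and> almost_disjoint e" by (intro exI[of _ "f \<circ> p"] conjI)
    with dispersed_of_two_dispersed[OF E] show False unfolding dispersed_def by (elim conjE notE)
  qed
  ultimately show "\<exists>f :: nat \<Rightarrow> 'a CK. (\<forall>n. f n \<in> unit_sphere) \<and> tau_null_seq (weak_sn \<union> abs_weak_sn) f \<and>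
      (\<forall>p :: nat \<Rightarrow> nat. \<not> almost_disjoint (f \<circ> p))"
    using sph by (intro exI[of _ f] conjI allI)
qed

theorem mainTheorem4:
  fixes K :: "'a::t2_space itself" and IDX :: "'p itself"
  assumes "compact (UNIV :: 'a set)"
    and "infinite (UNIV :: 'p set)"
  shows
    "(finite {x :: 'a. x islimpt UNIV} \<longleftrightarrow> finite_codim (oc_part :: 'a CK set))
   \<and> (finite {x :: 'a. x islimpt UNIV} \<longleftrightarrow> KP_property (pointwise_sn :: ('a CK \<Rightarrow> real) set) IDX)
   \<and> (finite {x :: 'a. x islimpt UNIV} \<longleftrightarrow> seq_KP_property (pointwise_sn :: ('a CK \<Rightarrow> real) set))
   \<and> (finite {x :: 'a. x islimpt UNIV} \<longleftrightarrow> seq_KP_property (weak_sn :: ('a CK \<Rightarrow> real) set))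
   \<and> (finite {x :: 'a. x islimpt UNIV} \<longleftrightarrow> seq_KP_property (abs_weak_sn :: ('a CK \<Rightarrow> real) set))
   \<and> (finite {x :: 'a. x islimpt UNIV} \<longleftrightarrow>
        \<not> (\<exists>E :: 'a CK set. closed_subspace E \<and> infinite_dim E \<and> dispersed E))
   \<and> (finite {x :: 'a. x islimpt UNIV} \<longleftrightarrow>
        \<not> (\<exists>E :: 'a CK set. closed_subspace E \<and> infinite_dim E \<and> two_dispersed E))"
proof -
  note K = assms(1)
  have IDX: "KP_property (pointwise_sn :: ('a CK \<Rightarrow> real) set) IDX \<longleftrightarrow>
      KP_property (pointwise_sn :: ('a CK \<Rightarrow> real) set) TYPE('p)"
    by (simp only: KP_property_def)
  show ?thesis
  proof (cases "finite {x :: 'a. x islimpt UNIV}")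
    case True
    \<comment> \<open>The net property over the natural numbers gives the sequential one, which
      passes from the pointwise seminorms to both larger families.\<close>
    note seq = seq_KP_of_KP[OF KP_pointwise[OF K True]]
    have "finite_codim (oc_part :: 'a CK set)"
      using finite_codim_vanishing[OF True] by (simp add: oc_part_eq[OF K])
    moreover have "\<not> (\<exists>E :: 'a CK set. closed_subspace E \<and> infinite_dim E \<and> dispersed E)"
      using no_dispersed[OF K True] unfolding closed_subspace_def by blast
    moreover have "\<not> (\<exists>E :: 'a CK set. closed_subspace E \<and> infinite_dim E \<and> two_dispersed E)"
      using calculation(2) dispersed_of_two_dispersed by blast
    ultimately show ?thesis
      using True seq KP_pointwise[OF K True, where 'p = 'p] seq_KP_antimono[OF seq pointwise_subset_weak]
        seq_KP_antimono[OF seq pointwise_subset_abs_weak]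
      unfolding IDX by blast
  next
    case False
    obtain f :: "nat \<Rightarrow> 'a CK" where f: "\<And>n. f n \<in> unit_sphere"
      "tau_null_seq (weak_sn \<union> abs_weak_sn) f" "\<And>p :: nat \<Rightarrow> nat. \<not> almost_disjoint (f \<circ> p)"
      using infinite_nonisolated_counterexamples(3)[OF K False] by blast
    \<comment> \<open>One sequence refutes all the topological conditions, the pointwise seminorms
      being among the weak ones.\<close>
    have null: "tau_null_seq Ns f" if "Ns \<subseteq> weak_sn \<union> abs_weak_sn" for Ns :: "('a CK \<Rightarrow> real) set"
      using f(2) that unfolding tau_null_seq_def by blast
    have "\<not> seq_KP_property Ns" if "Ns \<subseteq> weak_sn \<union> abs_weak_sn" for Ns :: "('a CK \<Rightarrow> real) set"
      using f(1,3) null[OF that] unfolding seq_KP_property_def by blast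
    then have "\<not> seq_KP_property (weak_sn :: ('a CK \<Rightarrow> real) set)"
      "\<not> seq_KP_property (abs_weak_sn :: ('a CK \<Rightarrow> real) set)"
      "\<not> seq_KP_property (pointwise_sn :: ('a CK \<Rightarrow> real) set)"
      using pointwise_subset_weak by blast+
    moreover have "\<not> KP_property (pointwise_sn :: ('a CK \<Rightarrow> real) set) IDX"
      unfolding IDX using not_KP_of_seq[OF assms(2) f(1) null f(3)] pointwise_subset_weak by blast
    moreover obtain E :: "'a CK set" where E: "infinite_dim E" "two_dispersed E"
      using infinite_nonisolated_counterexamples(2)[OF K False] by blast
    then have "\<exists>E :: 'a CK set. closed_subspace E \<and> infinite_dim E \<and> two_dispersed E"
      unfolding two_dispersed_def by blast
    moreover have "\<exists>E :: 'a CK set. closed_subspace E \<and> infinite_dim E \<and> dispersed E"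
      using E dispersed_of_two_dispersed unfolding two_dispersed_def by blast
    ultimately show ?thesis
      using False infinite_nonisolated_counterexamples(1)[OF K False] by blast
  qed
qed

end
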